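(* Let $\mathcal{A}$ be a commutative associative algebra over a field $\mathbb{F}$ and let $R:\mathcal{A}\to\mathcal{A}$ be a linear map such that $R(R(x))=R(x)$ and $R(x)\cdot R(y)=R(x\cdot y)$ for all $x,y\in\mathcal{A}$. Then the product $$x\circ y=R(x)\cdot R(y)-y\cdot R(x)$$ defines a (left) Pre-Lie algebra structure on $\mathcal{A}$. Respectively, the product $$x\circ y=R(x)\cdot y-R(y)\cdot R(x)$$ also defines a (left) Pre-Lie algebra structure on $\mathcal{A}$.
   Context: Algebras are not assumed to be unital. A left Pre-Lie algebra is an algebra $A$ over a field $\mathbb{F}$ with a bilinear product $\circ$ satisfying $(x\circ y)\circ z-x\circ(y\circ z)=(y\circ x)\circ z-y\circ(x\circ z)$ for all $x,y,z\in A$. *)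

theory Defs
  imports Complex_Main
begin

text \<open>Algebras are neither unital nor associative unless stated otherwise: a vector space
  with a bilinear product.\<close>

locale algebra_over_field = vector_space scale
  for scale :: "'f::field \<Rightarrow> 'a::ab_group_add \<Rightarrow> 'a" +
  fixes mult :: "'a \<Rightarrow> 'a \<Rightarrow> 'a"
  assumes linear_mult_right: "Vector_Spaces.linear scale scale (\<lambda>y. mult x y)"
    and linear_mult_left: "Vector_Spaces.linear scale scale (\<lambda>x. mult x y)"

locale comm_assoc_algebra = algebra_over_field scale mult + abel_semigroup mult
  for scale :: "'f::field \<Rightarrow> 'a::ab_group_add \<Rightarrow> 'a" and mult :: "'a \<Rightarrow> 'a \<Rightarrow> 'a"

locale left_pre_lie_algebra = algebra_over_field scale prod
  for scale :: "'f::field \<Rightarrow> 'a::ab_group_add \<Rightarrow> 'a" and prod :: "'a \<Rightarrow> 'a \<Rightarrow> 'a" +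
  assumes left_pre_lie:
    "prod (prod x y) z - prod x (prod y z) = prod (prod y x) z - prod y (prod x z)"

end

theory Submission imports Defs begin

text \<open>The key point is that \<open>x \<circ> y = R x \<cdot> R y - y \<cdot> R x\<close> lies in the kernel of \<open>R\<close>: as \<open>R\<close> is an
  idempotent endomorphism, \<open>R (x \<circ> y) = R x \<cdot> R y - R y \<cdot> R x\<close>, and the algebra is commutative.
  Left multiplication by \<open>x\<close> depends on \<open>x\<close> only through \<open>R x\<close>, so \<open>(x \<circ> y) \<circ> z = 0\<close>;
  and on the kernel of \<open>R\<close> it is multiplication by \<open>- R x\<close>, so that
  \<open>x \<circ> (y \<circ> z) = - (R x \<cdot> (y \<circ> z)) = (R x \<cdot> R y) \<cdot> (z - R z)\<close>, which is symmetric in \<open>x\<close> and \<open>y\<close>.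
  By commutativity the second product is the negative of the first, and the Pre-Lie identity is
  homogeneous of degree two in the product.\<close>

lemma (in algebra_over_field) additive_and_homogeneous:
  "mult x (y + z) = mult x y + mult x z" "mult x (scale c y) = scale c (mult x y)"
  "mult (x + y) z = mult x z + mult y z" "mult (scale c x) y = scale c (mult x y)"
  "mult x (y - z) = mult x y - mult x z" "mult (x - y) z = mult x z - mult y z"
  "mult x 0 = 0" "mult 0 x = 0" "mult x (- y) = - mult x y" "mult (- x) y = - mult x y"
proof -
  interpret right: Vector_Spaces.linear scale scale "\<lambda>y. mult x y" for x
    by (rule linear_mult_right)
  interpret left: Vector_Spaces.linear scale scale "\<lambda>x. mult x y" for y
    by (rule linear_mult_left)
  show "mult x (y + z) = mult x y + mult x z" "mult x (scale c y) = scale c (mult x y)"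
    "mult (x + y) z = mult x z + mult y z" "mult (scale c x) y = scale c (mult x y)"
    "mult x (y - z) = mult x y - mult x z" "mult (x - y) z = mult x z - mult y z"
    "mult x 0 = 0" "mult 0 x = 0" "mult x (- y) = - mult x y" "mult (- x) y = - mult x y"
    by (fact right.add right.scale left.add left.scale right.diff left.diff
        right.zero left.zero right.neg left.neg)+
qed

lemma (in vector_space) algebra_over_fieldI:
  assumes "\<And>x y z. mult x (y + z) = mult x y + mult x z"
    and "\<And>c x y. mult x (scale c y) = scale c (mult x y)"
    and "\<And>x y z. mult (x + y) z = mult x z + mult y z"
    and "\<And>c x y. mult (scale c x) y = scale c (mult x y)"
  shows "algebra_over_field scale mult"
  using assms by unfold_locales simp_all

text \<open>Every term of the Pre-Lie identity contains two products, so the two signs cancel.\<close>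

lemma (in left_pre_lie_algebra) left_pre_lie_algebra_uminus:
  "left_pre_lie_algebra scale (\<lambda>x y. - prod x y)"
proof (intro left_pre_lie_algebra.intro left_pre_lie_algebra_axioms.intro)
  show "algebra_over_field scale (\<lambda>x y. - prod x y)"
    by (rule algebra_over_fieldI) (simp_all add: additive_and_homogeneous scale_minus_right)
  show "- prod (- prod x y) z - - prod x (- prod y z)
      = - prod (- prod y x) z - - prod y (- prod x z)" for x y z
    using left_pre_lie[of x y z] by (simp add: additive_and_homogeneous)
qed

lemma (in comm_assoc_algebra) left_pre_lie_algebra_idempotent_endomorphism:
  assumes linear: "Vector_Spaces.linear scale scale R"
    and idem: "\<And>x. R (R x) = R x"
    and hom: "\<And>x y. mult (R x) (R y) = R (mult x y)"
  shows "left_pre_lie_algebra scale (\<lambda>x y. mult (R x) (R y) - mult y (R x))"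
    (is "left_pre_lie_algebra scale ?prod")
proof (intro left_pre_lie_algebra.intro left_pre_lie_algebra_axioms.intro)
  interpret R: Vector_Spaces.linear scale scale R by (rule linear)
  show "algebra_over_field scale ?prod"
    by (rule algebra_over_fieldI)
      (simp_all add: additive_and_homogeneous R.add R.scale scale_right_diff_distrib)
  have kernel: "R (?prod x y) = 0" for x y
    by (simp add: R.diff hom[symmetric] idem commute)
  \<comment> \<open>With \<open>kernel\<close> every nested product collapses: on the left it acts through its image under
    \<open>R\<close>, and on the right only the summand without \<open>R\<close> survives.\<close>
  have left_assoc: "?prod (?prod x y) z = 0" for x y z
    unfolding kernel by (simp add: additive_and_homogeneous)
  have right_assoc: "?prod x (?prod y z) = mult (mult (R x) (R y)) (z - R z)" for x y z
    unfolding kernel by (simp add: additive_and_homogeneous ac_simps)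
  show "?prod (?prod x y) z - ?prod x (?prod y z)
      = ?prod (?prod y x) z - ?prod y (?prod x z)" for x y z
    unfolding left_assoc right_assoc by (simp only: commute[of "R x" "R y"])
qed

theorem proposition4p0p3:
  fixes scale :: "'f::field \<Rightarrow> 'a::ab_group_add \<Rightarrow> 'a"
    and mult :: "'a \<Rightarrow> 'a \<Rightarrow> 'a" (infixl \<open>\<cdot>\<close> 70)
    and R :: "'a \<Rightarrow> 'a"
  assumes "comm_assoc_algebra scale mult"
    and "Vector_Spaces.linear scale scale R"
    and "\<And>x. R (R x) = R x"
    and "\<And>x y. R x \<cdot> R y = R (x \<cdot> y)"
  shows "left_pre_lie_algebra scale (\<lambda>x y. R x \<cdot> R y - y \<cdot> R x) \<and>
    left_pre_lie_algebra scale (\<lambda>x y. R x \<cdot> y - R y \<cdot> R x)"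
proof -
  interpret comm_assoc_algebra scale mult by (rule assms(1))
  have first: "left_pre_lie_algebra scale (\<lambda>x y. R x \<cdot> R y - y \<cdot> R x)"
    using assms(2-4) by (rule left_pre_lie_algebra_idempotent_endomorphism)
  have "(\<lambda>x y. R x \<cdot> y - R y \<cdot> R x) = (\<lambda>x y. - (R x \<cdot> R y - y \<cdot> R x))"
    by (simp add: commute)
  with first left_pre_lie_algebra.left_pre_lie_algebra_uminus[OF first] show ?thesis
    by simp
qed

end
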